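(* $F(\chi,1) = \{\text{claw}, \text{gem}, W_4, \text{butterfly}\}=F(\omega,1)$.
   Context: All graphs are finite and simple. The claw is $K_{1,3}$; the gem is the path $P_4$ together with an added vertex adjacent to all four path vertices; $W_4$ is the cycle $C_4$ together with an added vertex adjacent to all four cycle vertices; the butterfly is two triangles sharing exactly one vertex. $\Delta(H)$, $\omega(H)$, $\chi(H)$ denote maximum degree, clique number and chromatic number. For $k\in\mathbb{N}_0$: $\varOmega_k$ is the class of graphs $G$ such that every induced subgraph $H$ of $G$ (including $G$) satisfies $\Delta(H)\le\omega(H)+k-1$; $\varUpsilon_k$ is the class of graphs $G$ such that every induced subgraph $H$ of $G$ (including $G$) satisfies $\Delta(H)\le\chi(H)+k-1$. $F(\omega,k)$ (resp. $F(\chi,k)$) is the set of minimal forbidden induced subgraphs of $\varOmega_k$ (resp. $\varUpsilon_k$): graphs not in the class all of whose proper induced subgraphs are in the class (up to isomorphism). *)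

theory Defs
  imports
    "Graph_Theory.Kuratowski"
    "Graph_Theory.Digraph_Isomorphism"
begin

text \<open>
  A finite simple graph is represented as a finite symmetric loopfree digraph whose arcs are pairs
  of vertices (\<^term>\<open>pair_graph\<close>); an edge is a pair of opposite arcs. The null graph is excluded,
  so that maximum degree and clique number are maxima over nonempty sets and no inequality is
  required of an induced subgraph without vertices.
\<close>

definition simple_graph :: "'a pair_pre_digraph \<Rightarrow> bool" where
  "simple_graph G \<longleftrightarrow> pair_graph G \<and> pverts G \<noteq> {}"

text \<open>Since the arc relation is symmetric, the out-degree of a vertex is its degree.\<close>

definition max_degree :: "'a pair_pre_digraph \<Rightarrow> nat" where
  "max_degree G = Max (out_degree (with_proj G) ` pverts G)"

definition is_clique :: "'a pair_pre_digraph \<Rightarrow> 'a set \<Rightarrow> bool" where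
  "is_clique G K \<longleftrightarrow> K \<subseteq> pverts G \<and> (\<forall>u\<in>K. \<forall>v\<in>K. u \<noteq> v \<longrightarrow> (u, v) \<in> parcs G)"

definition clique_number :: "'a pair_pre_digraph \<Rightarrow> nat" where
  "clique_number G = Max (card ` {K. is_clique G K})"

definition proper_coloring :: "'a pair_pre_digraph \<Rightarrow> nat \<Rightarrow> ('a \<Rightarrow> nat) \<Rightarrow> bool" where
  "proper_coloring G n c \<longleftrightarrow>
     (\<forall>v\<in>pverts G. c v < n) \<and> (\<forall>(u, v)\<in>parcs G. c u \<noteq> c v)"

definition chromatic_number :: "'a pair_pre_digraph \<Rightarrow> nat" where
  "chromatic_number G = (LEAST n. \<exists>c. proper_coloring G n c)"

definition Omega_class :: "nat \<Rightarrow> 'a pair_pre_digraph set" where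
  "Omega_class k = {G. simple_graph G \<and>
     (\<forall>H. simple_graph H \<and> induced_subgraph (with_proj H) (with_proj G) \<longrightarrow>
        int (max_degree H) \<le> int (clique_number H) + int k - 1)}"

definition Upsilon_class :: "nat \<Rightarrow> 'a pair_pre_digraph set" where
  "Upsilon_class k = {G. simple_graph G \<and>
     (\<forall>H. simple_graph H \<and> induced_subgraph (with_proj H) (with_proj G) \<longrightarrow>
        int (max_degree H) \<le> int (chromatic_number H) + int k - 1)}"

definition minimal_forbidden :: "'a pair_pre_digraph set \<Rightarrow> 'a pair_pre_digraph set" where
  "minimal_forbidden \<C> = {G. simple_graph G \<and> G \<notin> \<C> \<and>
     (\<forall>H. simple_graph H \<and> induced_subgraph (with_proj H) (with_proj G) \<and> H \<noteq> G \<longrightarrow> H \<in> \<C>)}"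

definition F_omega :: "nat \<Rightarrow> 'a pair_pre_digraph set" where
  "F_omega k = minimal_forbidden (Omega_class k)"

definition F_chi :: "nat \<Rightarrow> 'a pair_pre_digraph set" where
  "F_chi k = minimal_forbidden (Upsilon_class k)"

text \<open>
  \<^term>\<open>F_omega k\<close> and \<^term>\<open>F_chi k\<close> are closed under isomorphism. A set of graphs taken up to
  isomorphism is therefore rendered by all graphs, on an arbitrary vertex type, that are isomorphic
  to one of its members.
\<close>

definition up_to_iso :: "'b pair_pre_digraph set \<Rightarrow> 'a pair_pre_digraph set" where
  "up_to_iso \<H> = {G. \<exists>H\<in>\<H>. digraph_iso (with_proj H) (with_proj G)}"

definition graph_of_edges :: "'a set \<Rightarrow> 'a rel \<Rightarrow> 'a pair_pre_digraph" where
  "graph_of_edges V E = \<lparr>pverts = V, parcs = E \<union> E\<inverse>\<rparr>"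

definition claw :: "nat pair_pre_digraph" where
  "claw = graph_of_edges {0, 1, 2, 3} {(0, 1), (0, 2), (0, 3)}"

definition gem :: "nat pair_pre_digraph" where
  "gem = graph_of_edges {0, 1, 2, 3, 4}
     {(0, 1), (1, 2), (2, 3), (4, 0), (4, 1), (4, 2), (4, 3)}"

definition W4 :: "nat pair_pre_digraph" where
  "W4 = graph_of_edges {0, 1, 2, 3, 4}
     {(0, 1), (1, 2), (2, 3), (3, 0), (4, 0), (4, 1), (4, 2), (4, 3)}"

text \<open>The triangles of the butterfly are \<open>0, 1, 2\<close> and \<open>0, 3, 4\<close>.\<close>

definition butterfly :: "nat pair_pre_digraph" where
  "butterfly = graph_of_edges {0, 1, 2, 3, 4}
     {(0, 1), (0, 2), (1, 2), (0, 3), (0, 4), (3, 4)}"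

lemma claw_complete_bipartite: "K\<^bsub>1,3\<^esub> (with_proj claw)"
  unfolding complete_bipartite_digraph_pair_def
proof (intro conjI exI)
  show "pverts claw = {0} \<union> {1, 2, 3}" "parcs claw = {0} \<times> {1, 2, 3} \<union> {1, 2, 3} \<times> {0}"
    by (auto simp: claw_def graph_of_edges_def)
qed (auto simp: claw_def graph_of_edges_def)

lemma simple_graph_of_edges:
  assumes "finite V" "V \<noteq> {}" "E \<subseteq> V \<times> V" "irrefl E"
  shows "simple_graph (graph_of_edges V E)"
proof -
  have "finite (E \<union> E\<inverse>)"
    using finite_subset[OF assms(3)] assms(1) by simp
  moreover have "sym (E \<union> E\<inverse>)"
    by (rule sym_Un_converse)
  ultimately have "pair_graph (graph_of_edges V E)"
    using assms by unfold_locales (auto simp: graph_of_edges_def symmetric_def irrefl_def)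
  then show ?thesis
    using assms(2) by (simp add: simple_graph_def graph_of_edges_def)
qed

lemma simple_graph_small:
  "simple_graph claw" "simple_graph gem" "simple_graph W4" "simple_graph butterfly"
  unfolding claw_def gem_def W4_def butterfly_def
  by (rule simple_graph_of_edges; auto simp: irrefl_def)+

lemma simple_graph_colorable:
  assumes "simple_graph G"
  shows "\<exists>n c. proper_coloring G n c"
proof -
  interpret pair_graph G using assms by (simp add: simple_graph_def)
  obtain c :: "'a \<Rightarrow> nat" and n where c: "c ` pverts G = {i. i < n}" "inj_on c (pverts G)"
    using finite_imp_inj_to_nat_seg[OF pair_finite_verts] by blast
  have "c u \<noteq> c v" if "(u, v) \<in> parcs G" for u v
    using that pair_no_loops[OF that] inj_onD[OF c(2)] by (auto dest: in_arcsD1 in_arcsD2)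
  then show ?thesis using c(1) unfolding proper_coloring_def by blast
qed

end

theory Submission
  imports Defs
begin

text \<open>
  Let \<open>v\<close> have maximum degree in \<open>G\<close>. If \<open>\<Delta>(G) > \<omega>(G)\<close>, then no clique of the neighbourhood \<open>N(v)\<close>
  misses at most one vertex of \<open>N(v)\<close>; that is, the non-edges inside \<open>N(v)\<close> cannot be covered by
  one vertex. Hence they contain a triangle, which gives a claw at \<open>v\<close>, or two disjoint non-edges
  \<open>ab\<close>, \<open>cd\<close>. In the latter case, and if there is no claw at \<open>v\<close>, the edges between \<open>{a, b}\<close> and
  \<open>{c, d}\<close> contain a perfect matching: two, three or four of them give a butterfly, a gem or a
  \<open>W\<^sub>4\<close> with centre \<open>v\<close>. Conversely, each of the four graphs satisfies \<open>\<Delta> > \<chi> \<ge> \<omega>\<close>, and none is a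
  proper induced subgraph of another: only the claw has fewer than five vertices, and the other
  three are covered by two cliques and thus contain no independent triple. The argument works for
  any parameter between \<open>\<omega>\<close> and \<open>\<chi>\<close>.
\<close>

section \<open>Simple graphs and induced embeddings\<close>

lemma simple_graph_iff:
  "simple_graph G \<longleftrightarrow> pverts G \<noteq> {} \<and> finite (pverts G) \<and> parcs G \<subseteq> pverts G \<times> pverts G
     \<and> sym (parcs G) \<and> irrefl (parcs G)"
proof
  assume G: "simple_graph G"
  then interpret pair_graph G by (simp add: simple_graph_def)
  show "pverts G \<noteq> {} \<and> finite (pverts G) \<and> parcs G \<subseteq> pverts G \<times> pverts G
     \<and> sym (parcs G) \<and> irrefl (parcs G)"
    using G pair_sym_arcs
    by (auto simp: simple_graph_def symmetric_def irrefl_def pair_finite_verts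
        dest: in_arcsD1 in_arcsD2 pair_no_loops)
next
  assume G: "pverts G \<noteq> {} \<and> finite (pverts G) \<and> parcs G \<subseteq> pverts G \<times> pverts G
     \<and> sym (parcs G) \<and> irrefl (parcs G)"
  then have "finite (parcs G)"
    by (meson finite_SigmaI finite_subset)
  with G have "pair_graph G"
    by unfold_locales (auto simp: symmetric_def irrefl_def)
  with G show "simple_graph G"
    by (simp add: simple_graph_def)
qed

lemma simple_graphD:
  assumes "simple_graph G"
  shows "pverts G \<noteq> {}" "finite (pverts G)" "parcs G \<subseteq> pverts G \<times> pverts G"
    "\<And>u v. (u, v) \<in> parcs G \<Longrightarrow> (v, u) \<in> parcs G" "\<And>u. (u, u) \<notin> parcs G"
  using assms by (auto simp: simple_graph_iff sym_def irrefl_def)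

lemma simple_graph_wf: "simple_graph G \<Longrightarrow> wf_digraph (with_proj G)"
  by (auto simp: simple_graph_iff wf_digraph_def)

lemma induced_subgraph_with_proj_iff:
  assumes "simple_graph H" "simple_graph G"
  shows "induced_subgraph (with_proj H) (with_proj G) \<longleftrightarrow>
    pverts H \<subseteq> pverts G \<and> parcs H = parcs G \<inter> pverts H \<times> pverts H"
  using assms by (auto simp: induced_subgraph_def subgraph_def simple_graph_wf)

text \<open>Expresses that \<open>G\<close> has an induced copy of \<open>X\<close> when the two
  graphs live on different vertex types: the four fixed graphs are on \<open>nat\<close>, while
  \<open>G\<close> is on an arbitrary type.\<close>

definition induced_embedding ::
    "('a \<Rightarrow> 'b) \<Rightarrow> 'a pair_pre_digraph \<Rightarrow> 'b pair_pre_digraph \<Rightarrow> bool" where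
  "induced_embedding f X G \<longleftrightarrow> inj_on f (pverts X) \<and> f ` pverts X \<subseteq> pverts G \<and>
     (\<forall>u\<in>pverts X. \<forall>v\<in>pverts X. (f u, f v) \<in> parcs G \<longleftrightarrow> (u, v) \<in> parcs X)"

lemma induced_embedding_comp:
  "induced_embedding f X Y \<Longrightarrow> induced_embedding g Y Z \<Longrightarrow> induced_embedding (g \<circ> f) X Z"
  unfolding induced_embedding_def image_subset_iff by (auto intro: comp_inj_on inj_on_subset)

lemma induced_embedding_inv:
  assumes "induced_embedding f X G" "f ` pverts X = pverts G"
  shows "induced_embedding (the_inv_into (pverts X) f) G X"
  using assms(1) unfolding induced_embedding_def assms(2)[symmetric]
  by (auto simp: the_inv_into_f_f inj_on_the_inv_into)

lemma induced_subgraph_embedding: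
  assumes "simple_graph H" "simple_graph G" "induced_subgraph (with_proj H) (with_proj G)"
  shows "induced_embedding id H G"
  using assms by (auto simp: induced_subgraph_with_proj_iff induced_embedding_def)

lemma induced_embedding_card_le:
  "induced_embedding f X G \<Longrightarrow> finite (pverts G) \<Longrightarrow> card (pverts X) \<le> card (pverts G)"
  unfolding induced_embedding_def by (metis card_inj_on_le)

text \<open>Reduces isomorphisms to vertex maps: an arc is the pair of its ends, so the arc map is
  forced by the vertex map. Simplicity of \<open>G\<close> is inherited from \<open>X\<close> along
  the isomorphism.\<close>

lemma digraph_iso_iff_embedding:
  assumes X: "simple_graph X"
  shows "digraph_iso (with_proj X) (with_proj G) \<longleftrightarrow>
    simple_graph G \<and> (\<exists>f. induced_embedding f X G \<and> f ` pverts X = pverts G)"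
proof -
  note X' = simple_graphD[OF X]
  show ?thesis
  proof
    assume "digraph_iso (with_proj X) (with_proj G)"
    then obtain h where h: "pre_digraph.digraph_isomorphism (with_proj X) h"
      and G: "with_proj G = app_iso h (with_proj X)"
      by (auto simp: digraph_iso_def)
    define f where "f = iso_verts h"
    \<comment> \<open>An isomorphism record also prescribes the tail and head functions of the
      image; as the image is again a \<open>with_proj\<close> graph, these are the
      projections.\<close>
    have tail_head: "iso_tail h = fst" "iso_head h = snd"
      using arg_cong[OF G, of tail] arg_cong[OF G, of head] by simp_all
    have vG: "pverts G = f ` pverts X" and aG: "parcs G = iso_arcs h ` parcs X"
      using arg_cong[OF G, of verts] arg_cong[OF G, of arcs] by (simp_all add: f_def)
    have inj: "inj_on f (pverts X)"
      using h by (simp add: pre_digraph.digraph_isomorphism_def f_def)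
    have "iso_arcs h e = map_prod f f e" if "e \<in> parcs X" for e
      using h that tail_head by (cases e) (auto simp: pre_digraph.digraph_isomorphism_def f_def prod_eq_iff)
    then have aG': "parcs G = map_prod f f ` parcs X"
      using aG by auto
    have arc_iff: "(f u, f v) \<in> parcs G \<longleftrightarrow> (u, v) \<in> parcs X"
      if uv: "u \<in> pverts X" "v \<in> pverts X" for u v
    proof
      assume "(f u, f v) \<in> parcs G"
      then obtain x y where xy: "(x, y) \<in> parcs X" "f u = f x" "f v = f y"
        by (auto simp: aG')
      then have "x \<in> pverts X" "y \<in> pverts X"
        using X'(3) by auto
      with xy uv have "u = x" "v = y"
        using inj by (auto dest: inj_onD)
      with xy show "(u, v) \<in> parcs X" by simp
    qed (force simp: aG')
    have "sym (parcs G)"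
      using X'(4) by (force simp: aG' sym_def)
    moreover have "irrefl (parcs G)"
      using X'(3,5) arc_iff by (force simp: aG' irrefl_def dest: inj_onD[OF inj])
    ultimately have "simple_graph G"
      using X' by (auto simp: simple_graph_iff vG aG')
    then show "simple_graph G \<and> (\<exists>f. induced_embedding f X G \<and> f ` pverts X = pverts G)"
      using inj arc_iff vG by (auto simp: induced_embedding_def)
  next
    assume "simple_graph G \<and> (\<exists>f. induced_embedding f X G \<and> f ` pverts X = pverts G)"
    then obtain f where G: "simple_graph G" and f: "induced_embedding f X G"
      and vG: "f ` pverts X = pverts G"
      by blast
    let ?h = "\<lparr>iso_verts = f, iso_arcs = map_prod f f, iso_head = snd, iso_tail = fst\<rparr>"
    have inj: "inj_on f (pverts X)"
      using f by (simp add: induced_embedding_def)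
    then have "inj_on (map_prod f f) (parcs X)"
      using inj_on_subset[OF map_prod_inj_on X'(3)] by blast
    with inj have "pre_digraph.digraph_isomorphism (with_proj X) ?h"
      by (simp add: pre_digraph.digraph_isomorphism_def simple_graph_wf[OF X])
    moreover have "parcs G = map_prod f f ` parcs X"
    proof
      show "parcs G \<subseteq> map_prod f f ` parcs X"
      proof
        fix e assume e: "e \<in> parcs G"
        then have "e \<in> f ` pverts X \<times> f ` pverts X"
          using simple_graphD(3)[OF G] vG by auto
        then obtain u v where "e = (f u, f v)" "u \<in> pverts X" "v \<in> pverts X"
          by auto
        with e f show "e \<in> map_prod f f ` parcs X"
          by (force simp: induced_embedding_def)
      qed
      show "map_prod f f ` parcs X \<subseteq> parcs G"
        using f X'(3) by (force simp: induced_embedding_def)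
    qed
    then have "with_proj G = app_iso ?h (with_proj X)"
      by (simp add: app_iso_def with_proj_def vG)
    ultimately show "digraph_iso (with_proj X) (with_proj G)"
      unfolding digraph_iso_def by blast
  qed
qed

text \<open>Minimality speaks of induced subgraphs on the vertex type of \<open>G\<close>; the
  subgraph induced on the range of \<open>f\<close> supplies one.\<close>

lemma induced_embedding_image:
  assumes X: "simple_graph X" and G: "simple_graph G" and f: "induced_embedding f X G"
  obtains K where "simple_graph K" "induced_subgraph (with_proj K) (with_proj G)"
    "digraph_iso (with_proj X) (with_proj K)"
proof
  let ?V = "f ` pverts X"
  let ?K = "\<lparr>pverts = ?V, parcs = parcs G \<inter> ?V \<times> ?V\<rparr>"
  have V: "?V \<subseteq> pverts G"
    using f by (simp add: induced_embedding_def)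
  have "sym (parcs G \<inter> ?V \<times> ?V)" "irrefl (parcs G \<inter> ?V \<times> ?V)"
    using simple_graphD(4,5)[OF G] by (blast intro: symI irreflI)+
  then show K: "simple_graph ?K"
    using simple_graphD(1,2)[OF X] by (simp add: simple_graph_iff)
  show "induced_subgraph (with_proj ?K) (with_proj G)"
    using V by (simp add: induced_subgraph_with_proj_iff[OF K G])
  have "induced_embedding f X ?K"
    using f by (simp add: induced_embedding_def)
  then show "digraph_iso (with_proj X) (with_proj ?K)"
    unfolding digraph_iso_iff_embedding[OF X] using K by auto
qed

section \<open>Degree, clique number and chromatic number\<close>

lemma out_degree_with_proj: "out_degree (with_proj G) v = card {w. (v, w) \<in> parcs G}"
proof -
  have "out_arcs (with_proj G) v = Pair v ` {w. (v, w) \<in> parcs G}"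
    by (auto simp: out_arcs_def)
  then show ?thesis
    by (simp add: out_degree_def card_image inj_on_def)
qed

lemma degree_le_max_degree:
  assumes "simple_graph G" "v \<in> pverts G"
  shows "card {w. (v, w) \<in> parcs G} \<le> max_degree G"
  unfolding max_degree_def out_degree_with_proj[symmetric]
  using assms by (intro Max_ge) (auto simp: simple_graphD(2))

lemma max_degree_attained:
  assumes "simple_graph G"
  obtains v where "v \<in> pverts G" "max_degree G = card {w. (v, w) \<in> parcs G}"
proof -
  have "max_degree G \<in> out_degree (with_proj G) ` pverts G"
    unfolding max_degree_def using simple_graphD(1,2)[OF assms] by (intro Max_in) auto
  then show thesis
    using that by (auto simp: out_degree_with_proj)
qed

lemma finite_cliques:
  assumes "simple_graph G"
  shows "finite {K. is_clique G K}"
proof (rule finite_subset)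
  show "{K. is_clique G K} \<subseteq> Pow (pverts G)"
    by (auto simp: is_clique_def)
  show "finite (Pow (pverts G))"
    using simple_graphD(2)[OF assms] by simp
qed

lemma clique_card_le_clique_number:
  "simple_graph G \<Longrightarrow> is_clique G K \<Longrightarrow> card K \<le> clique_number G"
  unfolding clique_number_def by (auto intro!: Max_ge finite_cliques)

lemma chromatic_number_le: "proper_coloring G n c \<Longrightarrow> chromatic_number G \<le> n"
  unfolding chromatic_number_def by (auto intro: Least_le)

lemma chromatic_number_coloring:
  assumes "simple_graph G"
  obtains c where "proper_coloring G (chromatic_number G) c"
  using simple_graph_colorable[OF assms] LeastI_ex[of "\<lambda>n. \<exists>c. proper_coloring G n c"] that
  unfolding chromatic_number_def by blast

text \<open>A proper coloring is injective on every clique.\<close>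

lemma clique_number_le_chromatic_number:
  assumes G: "simple_graph G"
  shows "clique_number G \<le> chromatic_number G"
proof -
  obtain c where c: "proper_coloring G (chromatic_number G) c"
    using chromatic_number_coloring[OF G] .
  have "card K \<le> chromatic_number G" if K: "is_clique G K" for K
  proof -
    have "inj_on c K"
      using c K by (fastforce simp: inj_on_def proper_coloring_def is_clique_def)
    moreover have "c ` K \<subseteq> {..<chromatic_number G}"
      using c K by (auto simp: proper_coloring_def is_clique_def)
    ultimately show ?thesis
      using card_inj_on_le[of c K "{..<chromatic_number G}"] by simp
  qed
  \<comment> \<open>The empty clique makes the set under \<open>Max\<close> nonempty.\<close>
  moreover have "is_clique G {}"
    by (simp add: is_clique_def)
  ultimately show ?thesis
    unfolding clique_number_def using finite_cliques[OF G] by (subst Max_le_iff) auto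
qed

text \<open>The neighbours of \<open>v\<close> are mapped injectively to neighbours of
  \<open>f v\<close>.\<close>

lemma max_degree_embedding_le:
  assumes X: "simple_graph X" and G: "simple_graph G" and f: "induced_embedding f X G"
  shows "max_degree X \<le> max_degree G"
proof -
  obtain v where v: "v \<in> pverts X" "max_degree X = card {w. (v, w) \<in> parcs X}"
    using max_degree_attained[OF X] .
  have N: "{w. (v, w) \<in> parcs X} \<subseteq> pverts X" "{w. (f v, w) \<in> parcs G} \<subseteq> pverts G"
    using simple_graphD(3)[OF X] simple_graphD(3)[OF G] by auto
  have "card {w. (v, w) \<in> parcs X} \<le> card {w. (f v, w) \<in> parcs G}"
  proof (rule card_inj_on_le)
    show "inj_on f {w. (v, w) \<in> parcs X}"
      using f N(1) unfolding induced_embedding_def by (metis inj_on_subset)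
    show "f ` {w. (v, w) \<in> parcs X} \<subseteq> {w. (f v, w) \<in> parcs G}"
      using f N(1) v(1) by (auto simp: induced_embedding_def)
    show "finite {w. (f v, w) \<in> parcs G}"
      using N(2) simple_graphD(2)[OF G] by (rule finite_subset)
  qed
  also have "\<dots> \<le> max_degree G"
    using f v(1) by (intro degree_le_max_degree[OF G]) (auto simp: induced_embedding_def)
  finally show ?thesis
    using v(2) by simp
qed

lemma chromatic_number_embedding_le:
  assumes X: "simple_graph X" and G: "simple_graph G" and f: "induced_embedding f X G"
  shows "chromatic_number X \<le> chromatic_number G"
proof -
  obtain c where c: "proper_coloring G (chromatic_number G) c"
    using chromatic_number_coloring[OF G] .
  \<comment> \<open>Colorings pull back along embeddings.\<close>
  have "proper_coloring X (chromatic_number G) (c \<circ> f)"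
    unfolding proper_coloring_def
  proof safe
    show "(c \<circ> f) v < chromatic_number G" if "v \<in> pverts X" for v
      using c f that by (auto simp: proper_coloring_def induced_embedding_def)
    show False if uv: "(u, v) \<in> parcs X" and eq: "(c \<circ> f) u = (c \<circ> f) v" for u v
    proof -
      have "(f u, f v) \<in> parcs G"
        using f uv simple_graphD(3)[OF X] unfolding induced_embedding_def by blast
      then show False
        using c eq by (auto simp: proper_coloring_def)
    qed
  qed
  then show ?thesis
    by (rule chromatic_number_le)
qed

section \<open>The four graphs\<close>

lemmas graph_defs = claw_def gem_def W4_def butterfly_def graph_of_edges_def

abbreviation (input) forbidden :: "nat pair_pre_digraph set" where
  "forbidden \<equiv> {claw, gem, W4, butterfly}"

lemma simple_graph_forbidden: "X \<in> forbidden \<Longrightarrow> simple_graph X"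
  using simple_graph_small by auto

lemma forbidden_chromatic_less_degree:
  assumes "X \<in> forbidden"
  shows "chromatic_number X < max_degree X"
proof -
  have bound: "chromatic_number X < max_degree X"
    if "simple_graph X" "proper_coloring X n c" "v \<in> pverts X" "n < card {w. (v, w) \<in> parcs X}"
    for X :: "nat pair_pre_digraph" and n c v
    using chromatic_number_le[OF that(2)] that(4) degree_le_max_degree[OF that(1,3)] by linarith
  \<comment> \<open>Each graph has a hub adjacent to all its other vertices: \<open>0\<close> in the
    claw and the butterfly, \<open>4\<close> in the gem and \<open>W4\<close>.\<close>
  have "{w. (0, w) \<in> parcs claw} = {1, 2, 3}" "{w. (4, w) \<in> parcs gem} = {0, 1, 2, 3}"
    "{w. (4, w) \<in> parcs W4} = {0, 1, 2, 3}" "{w. (0, w) \<in> parcs butterfly} = {1, 2, 3, 4}"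
    by (auto simp: graph_defs)
  then have "2 < card {w. (0, w) \<in> parcs claw}" "3 < card {w. (4, w) \<in> parcs gem}"
    "3 < card {w. (4, w) \<in> parcs W4}" "3 < card {w. (0, w) \<in> parcs butterfly}"
    by simp_all
  \<comment> \<open>The hub gets a color of its own. The rest is bipartite: the leaves of the claw
    share one color, elsewhere parity separates adjacent vertices.\<close>
  moreover have "proper_coloring claw 2 (\<lambda>i. if i = 0 then 0 else 1)"
    "proper_coloring gem 3 (\<lambda>i. if i = 4 then 2 else i mod 2)"
    "proper_coloring W4 3 (\<lambda>i. if i = 4 then 2 else i mod 2)"
    "proper_coloring butterfly 3 (\<lambda>i. if i = 0 then 2 else i mod 2)"
    by (auto simp: proper_coloring_def graph_defs)
  moreover have "0 \<in> pverts claw" "4 \<in> pverts gem" "4 \<in> pverts W4" "0 \<in> pverts butterfly"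
    by (auto simp: graph_defs)
  ultimately have "chromatic_number claw < max_degree claw" "chromatic_number gem < max_degree gem"
    "chromatic_number W4 < max_degree W4" "chromatic_number butterfly < max_degree butterfly"
    using simple_graph_small by (blast intro: bound)+
  with assms show ?thesis
    by blast
qed

lemma two_clique_cover:
  assumes "X \<in> {gem, W4, butterfly}"
  obtains A B where "is_clique X A" "is_clique X B" "pverts X = A \<union> B"
proof -
  have "is_clique gem {0, 1, 4}" "is_clique gem {2, 3, 4}" "pverts gem = {0, 1, 4} \<union> {2, 3, 4}"
    "is_clique W4 {0, 1, 4}" "is_clique W4 {2, 3, 4}" "pverts W4 = {0, 1, 4} \<union> {2, 3, 4}"
    "is_clique butterfly {0, 1, 2}" "is_clique butterfly {0, 3, 4}"
    "pverts butterfly = {0, 1, 2} \<union> {0, 3, 4}"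
    by (auto simp: is_clique_def graph_defs)
  with assms that show thesis
    by blast
qed

text \<open>By pigeonhole, two of the three leaves would land in the same clique of a two-clique
  cover, yet their images are distinct and nonadjacent.\<close>

lemma claw_not_embedded:
  assumes "X \<in> {gem, W4, butterfly}"
  shows "\<not> induced_embedding f claw X"
proof
  assume f: "induced_embedding f claw X"
  obtain A B where AB: "is_clique X A" "is_clique X B" "pverts X = A \<union> B"
    using two_clique_cover[OF assms] .
  have "1 \<in> pverts claw" "2 \<in> pverts claw" "3 \<in> pverts claw"
    "(1, 2) \<notin> parcs claw" "(1, 3) \<notin> parcs claw" "(2, 3) \<notin> parcs claw"
    by (auto simp: claw_def graph_of_edges_def)
  moreover have "inj_on f (pverts claw)"
    using f by (simp add: induced_embedding_def)
  ultimately have "(f 1, f 2) \<notin> parcs X" "(f 1, f 3) \<notin> parcs X" "(f 2, f 3) \<notin> parcs X"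
    and "f 1 \<noteq> f 2" "f 1 \<noteq> f 3" "f 2 \<noteq> f 3"
    and "f 1 \<in> A \<union> B" "f 2 \<in> A \<union> B" "f 3 \<in> A \<union> B"
    using f by (simp_all add: induced_embedding_def inj_on_eq_iff[of f "pverts claw"]
        image_subset_iff flip: AB(3))
  with AB(1,2) show False
    unfolding is_clique_def by (metis Un_iff)
qed

text \<open>Only the claw has fewer than five vertices, so the inequality could fail only for a claw
  inside one of the others. It is what rules out a forbidden graph inside a proper induced subgraph
  of another.\<close>

lemma forbidden_embedding_card:
  assumes "X \<in> forbidden" "Y \<in> forbidden" "induced_embedding f Y X"
  shows "card (pverts X) \<le> card (pverts Y)"
proof (cases "Y = claw")
  case True
  then have "X = claw"
    using assms claw_not_embedded by blast
  with True show ?thesis by simp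
next
  case False
  have "card (pverts claw) = 4" "card (pverts gem) = 5" "card (pverts W4) = 5"
    "card (pverts butterfly) = 5"
    by (simp_all add: graph_defs)
  with False assms(1,2) show ?thesis
    by auto
qed

section \<open>Graphs with maximum degree larger than the clique number\<close>

text \<open>Symmetry and irreflexivity of the arcs reduce the finite checks for the four graphs to
  the pairs with \<open>u < v\<close>.\<close>

lemma induced_embeddingI_less:
  fixes X :: "'b::linorder pair_pre_digraph"
  assumes X: "simple_graph X" and G: "simple_graph G"
    and "\<forall>u\<in>pverts X. f u \<in> pverts G"
    and less: "\<forall>u\<in>pverts X. \<forall>v\<in>pverts X. u < v \<longrightarrow>
      f u \<noteq> f v \<and> ((f u, f v) \<in> parcs G \<longleftrightarrow> (u, v) \<in> parcs X)"
  shows "induced_embedding f X G"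
proof -
  have "(f u, f v) \<in> parcs G \<longleftrightarrow> (u, v) \<in> parcs X"
    if "u \<in> pverts X" "v \<in> pverts X" for u v
    using less that simple_graphD(4,5)[OF X] simple_graphD(4,5)[OF G]
    by (cases u v rule: linorder_cases) metis+
  moreover have "inj_on f (pverts X)"
    using less by (intro linorder_inj_onI) auto
  ultimately show ?thesis
    using assms(3) by (auto simp: induced_embedding_def)
qed

context
  fixes G :: "'a pair_pre_digraph"
  assumes G: "simple_graph G"
begin

text \<open>List indexing sends vertex \<open>i\<close> of the fixed graph to entry
  \<open>i\<close>. Hence the hub comes first here and for the butterfly, last for the gem and
  \<open>W4\<close>, and arcs are assumed from the smaller to the larger index.\<close>

lemma claw_embedding:
  assumes "{v, a, b, c} \<subseteq> pverts G" "distinct [v, a, b, c]"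
    and "(v, a) \<in> parcs G" "(v, b) \<in> parcs G" "(v, c) \<in> parcs G"
    and "(a, b) \<notin> parcs G" "(a, c) \<notin> parcs G" "(b, c) \<notin> parcs G"
  shows "induced_embedding ((!) [v, a, b, c]) claw G"
  using simple_graph_small(1) G by (rule induced_embeddingI_less)
    (use assms in \<open>simp_all add: graph_defs\<close>)

lemma gem_embedding:
  assumes "{a, b, c, d, v} \<subseteq> pverts G" "distinct [a, b, c, d, v]"
    and "(a, v) \<in> parcs G" "(b, v) \<in> parcs G" "(c, v) \<in> parcs G" "(d, v) \<in> parcs G"
    and "(a, b) \<in> parcs G" "(b, c) \<in> parcs G" "(c, d) \<in> parcs G"
    and "(a, c) \<notin> parcs G" "(a, d) \<notin> parcs G" "(b, d) \<notin> parcs G"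
  shows "induced_embedding ((!) [a, b, c, d, v]) gem G"
  using simple_graph_small(2) G by (rule induced_embeddingI_less)
    (use assms in \<open>simp_all add: graph_defs\<close>)

lemma W4_embedding:
  assumes "{a, b, c, d, v} \<subseteq> pverts G" "distinct [a, b, c, d, v]"
    and "(a, v) \<in> parcs G" "(b, v) \<in> parcs G" "(c, v) \<in> parcs G" "(d, v) \<in> parcs G"
    and "(a, b) \<in> parcs G" "(b, c) \<in> parcs G" "(c, d) \<in> parcs G" "(a, d) \<in> parcs G"
    and "(a, c) \<notin> parcs G" "(b, d) \<notin> parcs G"
  shows "induced_embedding ((!) [a, b, c, d, v]) W4 G"
  using simple_graph_small(3) G by (rule induced_embeddingI_less)
    (use assms in \<open>simp_all add: graph_defs\<close>)

lemma butterfly_embedding: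
  assumes "{v, a, b, c, d} \<subseteq> pverts G" "distinct [v, a, b, c, d]"
    and "(v, a) \<in> parcs G" "(v, b) \<in> parcs G" "(v, c) \<in> parcs G" "(v, d) \<in> parcs G"
    and "(a, b) \<in> parcs G" "(c, d) \<in> parcs G"
    and "(a, c) \<notin> parcs G" "(a, d) \<notin> parcs G" "(b, c) \<notin> parcs G" "(b, d) \<notin> parcs G"
  shows "induced_embedding ((!) [v, a, b, c, d]) butterfly G"
  using simple_graph_small(4) G by (rule induced_embeddingI_less)
    (use assms in \<open>simp_all add: graph_defs\<close>)

lemma disjoint_non_edges_embedding:
  assumes v: "(v, a) \<in> parcs G" "(v, b) \<in> parcs G" "(v, c) \<in> parcs G" "(v, d) \<in> parcs G"
    and ne: "distinct [a, b, c, d]"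
    and non_edges: "(a, b) \<notin> parcs G" "(c, d) \<notin> parcs G"
  shows "\<exists>X\<in>forbidden. \<exists>f. induced_embedding f X G"
proof (rule ccontr)
  assume none: "\<not> ?thesis"
  note G' = simple_graphD(3-5)[OF G]
  have sym: "(x, y) \<in> parcs G \<longleftrightarrow> (y, x) \<in> parcs G" for x y
    using G'(2) by blast
  have V: "v \<in> pverts G" "a \<in> pverts G" "b \<in> pverts G" "c \<in> pverts G" "d \<in> pverts G"
    and vne: "v \<noteq> a" "v \<noteq> b" "v \<noteq> c" "v \<noteq> d"
    using v G' by auto
  have v': "(a, v) \<in> parcs G" "(b, v) \<in> parcs G" "(c, v) \<in> parcs G" "(d, v) \<in> parcs G"
    using v sym by auto
  note facts = V v v' ne vne non_edges
  \<comment> \<open>The four undetermined adjacencies become propositional variables, with both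
    orientations of an edge rewritten to the same one.\<close>
  define ac ad bc bd where "ac = ((a, c) \<in> parcs G)" and "ad = ((a, d) \<in> parcs G)"
    and "bc = ((b, c) \<in> parcs G)" and "bd = ((b, d) \<in> parcs G)"
  note arc_simps = ac_def[symmetric] ad_def[symmetric] bc_def[symmetric] bd_def[symmetric]
    sym[of c a, folded ac_def] sym[of d a, folded ad_def] sym[of c b, folded bc_def]
    sym[of d b, folded bd_def] sym[of b a] sym[of d c]
  \<comment> \<open>Without a claw at \<open>v\<close>, each of \<open>a\<close>, \<open>b\<close>,
    \<open>c\<close>, \<open>d\<close> has a neighbour in the opposite pair.\<close>
  have "ac \<or> bc"
    using none claw_embedding[of v a b c] facts by (auto simp: arc_simps)
  moreover have "ad \<or> bd"
    using none claw_embedding[of v a b d] facts by (auto simp: arc_simps)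
  moreover have "ac \<or> ad"
    using none claw_embedding[of v a c d] facts by (auto simp: arc_simps)
  moreover have "bc \<or> bd"
    using none claw_embedding[of v b c d] facts by (auto simp: arc_simps)
  \<comment> \<open>Exactly a perfect matching: each of its two edges forms a triangle with
    \<open>v\<close>.\<close>
  moreover have "\<not> (ac \<and> bd \<and> \<not> ad \<and> \<not> bc)"
    using none butterfly_embedding[of v a c b d] facts by (auto simp: arc_simps)
  moreover have "\<not> (ad \<and> bc \<and> \<not> ac \<and> \<not> bd)"
    using none butterfly_embedding[of v a d b c] facts by (auto simp: arc_simps)
  \<comment> \<open>Exactly three edges form an induced path on the four vertices; one case for each
    missing edge.\<close>
  moreover have "\<not> (ac \<and> bc \<and> bd \<and> \<not> ad)"
    using none gem_embedding[of a c b d v] facts by (auto simp: arc_simps)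
  moreover have "\<not> (ad \<and> bd \<and> bc \<and> \<not> ac)"
    using none gem_embedding[of a d b c v] facts by (auto simp: arc_simps)
  moreover have "\<not> (bc \<and> ac \<and> ad \<and> \<not> bd)"
    using none gem_embedding[of b c a d v] facts by (auto simp: arc_simps)
  moreover have "\<not> (bd \<and> ad \<and> ac \<and> \<not> bc)"
    using none gem_embedding[of b d a c v] facts by (auto simp: arc_simps)
  \<comment> \<open>All four edges form the induced cycle \<open>a\<close>, \<open>c\<close>,
    \<open>b\<close>, \<open>d\<close>.\<close>
  moreover have "\<not> (ac \<and> bc \<and> bd \<and> ad)"
    using none W4_embedding[of a c b d v] facts by (auto simp: arc_simps)
  ultimately show False
    by blast
qed

lemma clique_number_less_degree_embedding:
  assumes less: "clique_number G < max_degree G"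
  shows "\<exists>X\<in>forbidden. \<exists>f. induced_embedding f X G"
proof -
  note G' = simple_graphD(3-5)[OF G]
  obtain v where v: "v \<in> pverts G" "max_degree G = card {w. (v, w) \<in> parcs G}"
    using max_degree_attained[OF G] .
  define N where "N = {w. (v, w) \<in> parcs G}"
  have N: "N \<subseteq> pverts G" "v \<notin> N"
    using G' by (auto simp: N_def)
  then have fin: "finite N"
    using simple_graphD(2)[OF G] finite_subset by blast
  \<comment> \<open>Otherwise \<open>N - {u}\<close> together with \<open>v\<close> is a clique with
    at least \<open>card N\<close> vertices, and \<open>card N\<close> is the maximum
    degree.\<close>
  have non_edge: "\<exists>x\<in>N. \<exists>y\<in>N. x \<noteq> u \<and> y \<noteq> u \<and> x \<noteq> y \<and> (x, y) \<notin> parcs G" for u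
  proof (rule ccontr)
    assume "\<not> ?thesis"
    then have "is_clique G (insert v (N - {u}))"
      using N v(1) G'(2) by (auto simp: is_clique_def N_def)
    then have "card (insert v (N - {u})) \<le> clique_number G"
      by (rule clique_card_le_clique_number[OF G])
    moreover have "card N \<le> card (insert v (N - {u}))"
      using N(2) fin by (auto simp: card_Diff_singleton_if)
    ultimately show False
      using less v(2) by (simp add: N_def)
  qed
  have disj: ?thesis if "a \<in> N" "b \<in> N" "c \<in> N" "d \<in> N" "distinct [a, b, c, d]"
      "(a, b) \<notin> parcs G" "(c, d) \<notin> parcs G" for a b c d
    using that disjoint_non_edges_embedding[of v a b c d] by (simp add: N_def)
  \<comment> \<open>Two non-edges meeting in \<open>b\<close>. If \<open>ad\<close> is a non-edge
    too, there is a claw. If it is an edge, a non-edge avoiding \<open>b\<close> differs from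
    \<open>ad\<close>, so it is disjoint from \<open>ab\<close> or from \<open>bd\<close>.\<close>
  have path: ?thesis if "a \<in> N" "b \<in> N" "d \<in> N" "distinct [a, b, d]"
      "(a, b) \<notin> parcs G" "(b, d) \<notin> parcs G" for a b d
  proof (cases "(a, d) \<in> parcs G")
    case False
    then have "induced_embedding ((!) [v, a, b, d]) claw G"
      using that N v(1) by (intro claw_embedding) (auto simp: N_def)
    then show ?thesis by blast
  next
    case True
    obtain e g where eg: "e \<in> N" "g \<in> N" "e \<noteq> b" "g \<noteq> b" "e \<noteq> g"
      "(e, g) \<notin> parcs G" "(g, e) \<notin> parcs G"
      using non_edge[of b] G'(2) by blast
    have "(b, a) \<notin> parcs G" "(d, b) \<notin> parcs G" "(d, a) \<in> parcs G"
      using that True G'(2) by blast+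
    then consider "distinct [a, b, e, g]" | "e = a" "g \<noteq> d" | "g = a" "e \<noteq> d"
      using eg that True by auto
    then show ?thesis
      by cases (use that eg disj[of a b e g] disj[of a g b d] disj[of a e b d] in auto)
  qed
  \<comment> \<open>As \<open>v\<close> is not in \<open>N\<close>, the choice \<open>u = v\<close>
    excludes nothing and yields some non-edge.\<close>
  obtain a b where ab: "a \<in> N" "b \<in> N" "a \<noteq> b" "(a, b) \<notin> parcs G" "(b, a) \<notin> parcs G"
    using non_edge[of v] G'(2) by blast
  \<comment> \<open>A non-edge avoiding \<open>a\<close> is either disjoint from \<open>ab\<close>
    or meets it exactly in \<open>b\<close>.\<close>
  obtain c d where cd: "c \<in> N" "d \<in> N" "c \<noteq> a" "d \<noteq> a" "c \<noteq> d"
    "(c, d) \<notin> parcs G" "(d, c) \<notin> parcs G"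
    using non_edge[of a] G'(2) by blast
  consider "c = b" | "d = b" | "c \<noteq> b" "d \<noteq> b"
    by blast
  then show ?thesis
    by cases (use ab cd disj[of a b c d] path[of a b d] path[of a b c] in auto)
qed

end

section \<open>Minimal forbidden induced subgraphs\<close>

text \<open>Handles both classes at once. The lower bound on \<open>p\<close> gives every graph
  outside \<open>C\<close> an induced copy of one of the four; the upper bound keeps the four
  themselves outside \<open>C\<close>.\<close>

lemma minimal_forbidden_between_clique_and_chromatic:
  fixes p :: "'a pair_pre_digraph \<Rightarrow> nat"
  assumes p: "\<And>G. simple_graph G \<Longrightarrow> clique_number G \<le> p G"
    "\<And>G. simple_graph G \<Longrightarrow> p G \<le> chromatic_number G"
    and C: "C = {G. simple_graph G \<and> (\<forall>H. simple_graph H \<and>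
      induced_subgraph (with_proj H) (with_proj G) \<longrightarrow> max_degree H \<le> p H)}"
  shows "minimal_forbidden C = up_to_iso forbidden"
proof -
  have contains: "\<exists>H X f. simple_graph H \<and> induced_subgraph (with_proj H) (with_proj G) \<and>
      X \<in> forbidden \<and> induced_embedding f X H"
    if "simple_graph G" "G \<notin> C" for G
  proof -
    have "\<exists>H. simple_graph H \<and> induced_subgraph (with_proj H) (with_proj G) \<and> p H < max_degree H"
      using that by (simp add: C not_le)
    then obtain H where H: "simple_graph H" "induced_subgraph (with_proj H) (with_proj G)"
      "p H < max_degree H"
      by blast
    with p(1)[OF H(1)] have "\<exists>X\<in>forbidden. \<exists>f. induced_embedding f X H"
      by (intro clique_number_less_degree_embedding) auto
    with H show ?thesis by blast
  qed
  \<comment> \<open>\<open>G\<close> itself violates the bound: \<open>p G\<close> is at most the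
    chromatic number of \<open>G\<close>, hence at most that of \<open>X\<close> by the inverse
    embedding, and so is below the maximum degree of \<open>X\<close>, which is at most that of
    \<open>G\<close>.\<close>
  have not_in: "simple_graph G \<and> G \<notin> C"
    if X: "X \<in> forbidden" and iso: "digraph_iso (with_proj X) (with_proj G)"
    for X and G :: "'a pair_pre_digraph"
  proof -
    note sX = simple_graph_forbidden[OF X]
    obtain f where G: "simple_graph G" and f: "induced_embedding f X G" "f ` pverts X = pverts G"
      using iso digraph_iso_iff_embedding[OF sX] by blast
    have "p G \<le> chromatic_number X"
      using p(2)[OF G] chromatic_number_embedding_le[OF G sX induced_embedding_inv[OF f]] by simp
    also have "\<dots> < max_degree X"
      using X by (rule forbidden_chromatic_less_degree)
    also have "\<dots> \<le> max_degree G"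
      using sX G f(1) by (rule max_degree_embedding_le)
    finally have "p G < max_degree G" .
    moreover have "induced_subgraph (with_proj G) (with_proj G)"
      using simple_graphD(3)[OF G] by (auto simp: induced_subgraph_with_proj_iff G)
    ultimately show ?thesis
      using G by (auto simp: C not_le)
  qed
  show ?thesis
  proof (intro set_eqI iffI)
    fix G :: "'a pair_pre_digraph"
    assume "G \<in> minimal_forbidden C"
    then have G: "simple_graph G" "G \<notin> C"
      and minimal: "\<And>H. simple_graph H \<Longrightarrow> induced_subgraph (with_proj H) (with_proj G) \<Longrightarrow>
        H \<noteq> G \<Longrightarrow> H \<in> C"
      by (auto simp: minimal_forbidden_def)
    obtain H X f where H: "simple_graph H" "induced_subgraph (with_proj H) (with_proj G)"
      and X: "X \<in> forbidden" and f: "induced_embedding f X H"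
      using contains[OF G] by blast
    have "induced_embedding (id \<circ> f) X G"
      using f induced_subgraph_embedding[OF H(1) G(1) H(2)] by (rule induced_embedding_comp)
    then obtain K where K: "simple_graph K" "induced_subgraph (with_proj K) (with_proj G)"
      "digraph_iso (with_proj X) (with_proj K)"
      using induced_embedding_image[OF simple_graph_forbidden[OF X] G(1)] by blast
    \<comment> \<open>The copy \<open>K\<close> of \<open>X\<close> lies outside \<open>C\<close>,
      so minimality of \<open>G\<close> leaves no other possibility.\<close>
    with not_in[OF X K(3)] minimal have "K = G"
      by blast
    with K X show "G \<in> up_to_iso forbidden"
      by (auto simp: up_to_iso_def)
  next
    fix G :: "'a pair_pre_digraph"
    assume "G \<in> up_to_iso forbidden"
    then obtain X where X: "X \<in> forbidden" and iso: "digraph_iso (with_proj X) (with_proj G)"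
      unfolding up_to_iso_def by blast
    note sX = simple_graph_forbidden[OF X]
    obtain f where G: "simple_graph G" and f: "induced_embedding f X G" "f ` pverts X = pverts G"
      using iso digraph_iso_iff_embedding[OF sX] by blast
    \<comment> \<open>Otherwise some forbidden \<open>Y\<close> embeds into \<open>H\<close>, hence
      through \<open>G\<close> into \<open>X\<close>, and the vertex counts give |X| \<le> |Y| \<le>
      |H| < |G| = |X|.\<close>
    have "H \<in> C" if H: "simple_graph H" "induced_subgraph (with_proj H) (with_proj G)" "H \<noteq> G" for H
    proof (rule ccontr)
      assume "H \<notin> C"
      then obtain K Y g where K: "simple_graph K" "induced_subgraph (with_proj K) (with_proj H)"
        and Y: "Y \<in> forbidden" and g: "induced_embedding g Y K"
        using contains[OF H(1)] by blast
      have gH: "induced_embedding (id \<circ> g) Y H"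
        using g induced_subgraph_embedding[OF K(1) H(1) K(2)] by (rule induced_embedding_comp)
      then have "induced_embedding (the_inv_into (pverts X) f \<circ> (id \<circ> (id \<circ> g))) Y X"
        using induced_subgraph_embedding[OF H(1) G H(2)] induced_embedding_inv[OF f]
        by (blast intro: induced_embedding_comp)
      then have "card (pverts X) \<le> card (pverts Y)"
        by (rule forbidden_embedding_card[OF X Y])
      also have "\<dots> \<le> card (pverts H)"
        using gH simple_graphD(2)[OF H(1)] by (rule induced_embedding_card_le)
      also have "\<dots> < card (pverts G)"
      proof (rule psubset_card_mono)
        \<comment> \<open>An induced subgraph is determined by its vertex set, so
          \<open>H \<noteq> G\<close> costs at least one vertex.\<close>
        have "pverts H \<noteq> pverts G"
          using H simple_graphD(3)[OF G]
          by (auto simp: induced_subgraph_with_proj_iff G intro!: pair_pre_digraph.equality)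
        then show "pverts H \<subset> pverts G"
          using H by (auto simp: induced_subgraph_with_proj_iff G)
      qed (use simple_graphD(2)[OF G] in simp)
      also have "\<dots> = card (pverts X)"
        using f by (metis card_image induced_embedding_def)
      finally show False by simp
    qed
    with not_in[OF X iso] show "G \<in> minimal_forbidden C"
      by (auto simp: minimal_forbidden_def)
  qed
qed

theorem theorem5:
  shows "(F_chi 1 :: 'a pair_pre_digraph set) = up_to_iso {claw, gem, W4, butterfly}
       \<and> (up_to_iso {claw, gem, W4, butterfly} :: 'a pair_pre_digraph set) = F_omega 1"
proof
  \<comment> \<open>For \<open>k = 1\<close> the summand \<open>int k - 1\<close> vanishes and the
    integer bound becomes the inequality between naturals in \<open>C\<close>; \<open>p\<close> is
    an end of its allowed range, here the upper one and below the lower one.\<close>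
  show "(F_chi 1 :: 'a pair_pre_digraph set) = up_to_iso {claw, gem, W4, butterfly}"
    unfolding F_chi_def
    by (rule minimal_forbidden_between_clique_and_chromatic[of chromatic_number])
      (auto simp: Upsilon_class_def clique_number_le_chromatic_number)
  show "(up_to_iso {claw, gem, W4, butterfly} :: 'a pair_pre_digraph set) = F_omega 1"
    unfolding F_omega_def
    by (rule minimal_forbidden_between_clique_and_chromatic[of clique_number, symmetric])
      (auto simp: Omega_class_def clique_number_le_chromatic_number)
qed

end
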